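(* A topological space $X$ has DMOP (the discrete moving off property) if and only if the player $\mathsf F$ has no winning strategy in the game $\mathsf{G_{KF}}(X)$.
   Context: A point $x\in X$ is isolated if $\{x\}$ is clopen in $X$; $\dot X$ is the set of isolated points of $X$. A family $\mathcal F$ of subsets of $X$ is moving off if for every compact $K\subset X$ there is a non-empty $F\in\mathcal F$ with $K\cap F=\emptyset$. A family is discrete in $X$ if each point of $X$ has a neighborhood meeting at most one member of the family; an indexed family $\{F_n\}_{n}$ is discrete if each point of $X$ has a neighborhood meeting $F_n$ for at most one index $n$. $X$ has DMOP if every moving off family of finite subsets of $\dot X$ contains an infinite subfamily that is discrete in $X$. Game $\mathsf{G_{KF}}(X)$: played by $\mathsf K$ and $\mathsf F$; $\mathsf K$ starts. At the $n$-th inning ($n\in\mathbb N$) $\mathsf K$ chooses a compact subset $K_n\subset X$ and $\mathsf F$ responds with a finite subset $F_n\subset\dot X$ such that $F_n\cap K_n=\emptyset$. Player $\mathsf K$ wins if the (indexed) family $\{F_n\}_{n\in\mathbb N}$ is discrete in $X$; otherwise $\mathsf F$ wins. A strategy of $\mathsf F$ is a function assigning to each finite sequence $(K_1,\dots,K_n)$ of compact subsets of $X$ a finite set $F_n\subset\dot X\setminus K_n$. *)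

theory Defs
  imports "HOL-Analysis.Abstract_Topology"
begin

text \<open>Points \<^term>\<open>x\<close> such that the singleton is clopen; in a non-T1 space this is stronger
  than the singleton being open.\<close>

definition isolated_points :: "'a topology \<Rightarrow> 'a set" where
  "isolated_points X = {x \<in> topspace X. openin X {x} \<and> closedin X {x}}"

definition moving_off :: "'a topology \<Rightarrow> 'a set set \<Rightarrow> bool" where
  "moving_off X \<F> \<longleftrightarrow>
     (\<forall>F\<in>\<F>. F \<subseteq> topspace X) \<and>
     (\<forall>K. compactin X K \<longrightarrow> (\<exists>F\<in>\<F>. F \<noteq> {} \<and> K \<inter> F = {}))"

definition discrete_family :: "'a topology \<Rightarrow> 'a set set \<Rightarrow> bool" where
  "discrete_family X \<D> \<longleftrightarrow>
     (\<forall>x\<in>topspace X. \<exists>U. openin X U \<and> x \<in> U \<and>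
        (\<exists>\<^sub>\<le>\<^sub>1 D. D \<in> \<D> \<and> D \<inter> U \<noteq> {}))"

text \<open>Unlike discreteness of \<^term>\<open>range F\<close>, the indexed notion forbids repeating a
  non-empty set at two different indices.\<close>

definition discrete_sequence :: "'a topology \<Rightarrow> (nat \<Rightarrow> 'a set) \<Rightarrow> bool" where
  "discrete_sequence X F \<longleftrightarrow>
     (\<forall>x\<in>topspace X. \<exists>U. openin X U \<and> x \<in> U \<and> (\<exists>\<^sub>\<le>\<^sub>1 n. F n \<inter> U \<noteq> {}))"

definition DMOP :: "'a topology \<Rightarrow> bool" where
  "DMOP X \<longleftrightarrow>
     (\<forall>\<F>. (\<forall>F\<in>\<F>. finite F \<and> F \<subseteq> isolated_points X) \<and> moving_off X \<F> \<longrightarrow>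
        (\<exists>\<D>\<subseteq>\<F>. infinite \<D> \<and> discrete_family X \<D>))"

text \<open>A play of the game is given by the moves \<open>K 0, K 1, \<dots>\<close> of the first player and the
  replies \<open>F 0, F 1, \<dots>\<close> of the second one; innings are numbered from 0.\<close>

definition GKF_play :: "'a topology \<Rightarrow> (nat \<Rightarrow> 'a set) \<Rightarrow> (nat \<Rightarrow> 'a set) \<Rightarrow> bool" where
  "GKF_play X K F \<longleftrightarrow>
     (\<forall>n. compactin X (K n) \<and> finite (F n) \<and> F n \<subseteq> isolated_points X \<and> F n \<inter> K n = {})"

definition GKF_K_wins :: "'a topology \<Rightarrow> (nat \<Rightarrow> 'a set) \<Rightarrow> bool" where
  "GKF_K_wins X F \<longleftrightarrow> discrete_sequence X F"

text \<open>A strategy sees all moves of the opponent so far, in chronological order. Its values on the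
  empty list and on lists with a non-compact entry are irrelevant.\<close>

definition GKF_F_strategy :: "'a topology \<Rightarrow> ('a set list \<Rightarrow> 'a set) \<Rightarrow> bool" where
  "GKF_F_strategy X \<sigma> \<longleftrightarrow>
     (\<forall>Ks. Ks \<noteq> [] \<and> (\<forall>K\<in>set Ks. compactin X K) \<longrightarrow>
        finite (\<sigma> Ks) \<and> \<sigma> Ks \<subseteq> isolated_points X - last Ks)"

definition GKF_F_winning_strategy :: "'a topology \<Rightarrow> ('a set list \<Rightarrow> 'a set) \<Rightarrow> bool" where
  "GKF_F_winning_strategy X \<sigma> \<longleftrightarrow>
     GKF_F_strategy X \<sigma> \<and>
     (\<forall>K F. GKF_play X K F \<and> (\<forall>n. F n = \<sigma> (map K [0..<Suc n])) \<longrightarrow> \<not> GKF_K_wins X F)"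

end

theory Submission
  imports Defs "HOL-Library.Countable"
begin

text \<open>A moving off family without infinite discrete subfamily gives the second player a winning
  strategy: answer \<open>K\<close> by a non-empty member of the family missing \<open>K\<close>.

  Conversely, let \<open>\<sigma>\<close> be a strategy of the second player, without loss of generality with
  non-empty replies. By DMOP, in every position countably many moves suffice to produce, for each
  compact set \<open>K\<close>, a reply missing \<open>K\<close>. This leaves a countable tree of positions. For
  a function \<open>g\<close> selecting one of these moves at each node, let \<open>H g\<close> be the union of the replies to
  the moves selected by \<open>g\<close> at the root and at the first \<open>g []\<close> nodes. The family of all
  \<open>H g\<close> is moving off, and members with the same value \<open>g []\<close> meet. Hence in an
  infinite discrete subfamily the numbers \<open>g []\<close> are unbounded, so every node is eventually handled,
  and one climbs a branch of the tree using a new member of the subfamily at each step.\<close>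

section \<open>Discrete families and discrete sequences\<close>

lemma isolated_points_subset_topspace: "isolated_points X \<subseteq> topspace X"
  by (auto simp: isolated_points_def)

lemma discrete_family_meet_eq:
  assumes "discrete_family X \<D>" "A \<in> \<D>" "B \<in> \<D>" "x \<in> A" "x \<in> B" "x \<in> topspace X"
  shows "A = B"
proof -
  obtain U where U: "x \<in> U" and le1: "\<exists>\<^sub>\<le>\<^sub>1 D. D \<in> \<D> \<and> D \<inter> U \<noteq> {}"
    using assms unfolding discrete_family_def by blast
  show ?thesis
    using Uniq_D[OF le1, of A B] U assms(2-5) by blast
qed

lemma discrete_sequence_mono:
  assumes "discrete_sequence X F" "\<And>n. G n \<subseteq> F n"
  shows "discrete_sequence X G"
  unfolding discrete_sequence_def
proof
  fix x assume "x \<in> topspace X"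
  then obtain U where U: "openin X U" "x \<in> U" and le1: "\<exists>\<^sub>\<le>\<^sub>1 n. F n \<inter> U \<noteq> {}"
    using assms(1) unfolding discrete_sequence_def by blast
  have "\<exists>\<^sub>\<le>\<^sub>1 n. G n \<inter> U \<noteq> {}"
    using le1 assms(2) unfolding Uniq_def by blast
  with U show "\<exists>U. openin X U \<and> x \<in> U \<and> (\<exists>\<^sub>\<le>\<^sub>1 n. G n \<inter> U \<noteq> {})"
    by blast
qed

lemma discrete_sequence_of_family:
  assumes "discrete_family X \<D>" "inj D" "range D \<subseteq> \<D>"
  shows "discrete_sequence X D"
  unfolding discrete_sequence_def
proof
  fix x assume "x \<in> topspace X"
  then obtain U where U: "openin X U" "x \<in> U" and le1: "\<exists>\<^sub>\<le>\<^sub>1 D. D \<in> \<D> \<and> D \<inter> U \<noteq> {}"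
    using assms(1) unfolding discrete_family_def by blast
  have "\<exists>\<^sub>\<le>\<^sub>1 n. D n \<inter> U \<noteq> {}"
  proof (rule Uniq_I)
    fix m n assume "D m \<inter> U \<noteq> {}" "D n \<inter> U \<noteq> {}"
    then have "D m = D n"
      using Uniq_D[OF le1] assms(3) by blast
    then show "m = n"
      using assms(2) by (simp add: inj_eq)
  qed
  with U show "\<exists>U. openin X U \<and> x \<in> U \<and> (\<exists>\<^sub>\<le>\<^sub>1 n. D n \<inter> U \<noteq> {})"
    by blast
qed

lemma discrete_sequence_imp_family:
  assumes "discrete_sequence X F"
  shows "discrete_family X (range F)"
  unfolding discrete_family_def
proof
  fix x assume "x \<in> topspace X"
  then obtain U where U: "openin X U" "x \<in> U" and le1: "\<exists>\<^sub>\<le>\<^sub>1 n. F n \<inter> U \<noteq> {}"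
    using assms unfolding discrete_sequence_def by blast
  have "\<exists>\<^sub>\<le>\<^sub>1 D. D \<in> range F \<and> D \<inter> U \<noteq> {}"
    using Uniq_D[OF le1] by (intro Uniq_I) blast
  with U show "\<exists>U. openin X U \<and> x \<in> U \<and> (\<exists>\<^sub>\<le>\<^sub>1 D. D \<in> range F \<and> D \<inter> U \<noteq> {})"
    by blast
qed

text \<open>Every neighborhood of a point of a repeated set would meet the sequence at two indices.
  This turns an indexed discrete sequence of replies into an infinite family.\<close>

lemma discrete_sequence_inj:
  assumes "discrete_sequence X F" "\<And>n. F n \<noteq> {}" "\<And>n. F n \<subseteq> topspace X"
  shows "inj F"
proof (rule injI)
  fix m n assume eq: "F m = F n"
  obtain x where x: "x \<in> F m" "x \<in> topspace X"
    using assms(2,3) by blast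
  then obtain U where U: "x \<in> U" and le1: "\<exists>\<^sub>\<le>\<^sub>1 n. F n \<inter> U \<noteq> {}"
    using assms(1) unfolding discrete_sequence_def by blast
  show "m = n"
    using Uniq_D[OF le1, of m n] U x eq by blast
qed

text \<open>Finitely many of the neighborhoods that witness discreteness cover \<open>K\<close>, and
  each of them meets at most one member.\<close>

lemma discrete_family_finite_meeting_compact:
  assumes "discrete_family X \<D>" "compactin X K"
  shows "finite {D \<in> \<D>. D \<inter> K \<noteq> {}}"
proof -
  have KX: "K \<subseteq> topspace X"
    using assms(2) by (rule compactin_subset_topspace)
  obtain U where U: "\<And>x. x \<in> topspace X \<Longrightarrow>
      openin X (U x) \<and> x \<in> U x \<and> (\<exists>\<^sub>\<le>\<^sub>1 D. D \<in> \<D> \<and> D \<inter> U x \<noteq> {})"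
    using assms(1) unfolding discrete_family_def by metis
  have "K \<subseteq> \<Union>(U ` K)" and "\<And>V. V \<in> U ` K \<Longrightarrow> openin X V"
    using U KX by auto
  then obtain \<V> where \<V>: "finite \<V>" "\<V> \<subseteq> U ` K" "K \<subseteq> \<Union>\<V>"
    using assms(2) unfolding compactin_def by meson
  have "finite {D \<in> \<D>. D \<inter> V \<noteq> {}}" if "V \<in> \<V>" for V
  proof -
    have le1: "\<exists>\<^sub>\<le>\<^sub>1 D. D \<in> \<D> \<and> D \<inter> V \<noteq> {}"
      using that \<V>(2) U KX by blast
    show ?thesis
    proof (cases "{D \<in> \<D>. D \<inter> V \<noteq> {}} = {}")
      case False
      then obtain A where A: "A \<in> \<D>" "A \<inter> V \<noteq> {}" by blast
      then have "{D \<in> \<D>. D \<inter> V \<noteq> {}} \<subseteq> {A}"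
        using Uniq_D[OF le1] by blast
      then show ?thesis
        using finite_subset by blast
    next
      case True
      then show ?thesis
        by (simp only: finite.emptyI)
    qed
  qed
  then have "finite (\<Union>V\<in>\<V>. {D \<in> \<D>. D \<inter> V \<noteq> {}})"
    using \<V>(1) by blast
  moreover have "{D \<in> \<D>. D \<inter> K \<noteq> {}} \<subseteq> (\<Union>V\<in>\<V>. {D \<in> \<D>. D \<inter> V \<noteq> {}})"
    using \<V>(3) by blast
  ultimately show ?thesis
    using finite_subset by blast
qed

section \<open>Countable selection from moving off families\<close>

lemma DMOP_E:
  assumes "DMOP X" "moving_off X \<F>" "\<And>F. F \<in> \<F> \<Longrightarrow> finite F \<and> F \<subseteq> isolated_points X"
  obtains \<D> where "\<D> \<subseteq> \<F>" "infinite \<D>" "discrete_family X \<D>"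
proof -
  have "\<exists>\<D>\<subseteq>\<F>. infinite \<D> \<and> discrete_family X \<D>"
    using assms(1)[unfolded DMOP_def, rule_format, of \<F>] assms(2,3) by simp
  then show thesis
    using that by auto
qed

text \<open>Any injective sequence in an infinite discrete subfamily works: a compact set meets only
  finitely many members, so it cannot meet all terms.\<close>

lemma DMOP_countable_moving_off:
  assumes "DMOP X" "moving_off X \<F>" "\<And>F. F \<in> \<F> \<Longrightarrow> finite F \<and> F \<subseteq> isolated_points X"
  shows "\<exists>f :: nat \<Rightarrow> 'a set. range f \<subseteq> \<F> \<and> (\<forall>K. compactin X K \<longrightarrow> (\<exists>n. f n \<inter> K = {}))"
proof -
  obtain \<D> where \<D>: "\<D> \<subseteq> \<F>" "infinite \<D>" "discrete_family X \<D>"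
    using DMOP_E[OF assms] .
  obtain f :: "nat \<Rightarrow> 'a set" where f: "inj f" "range f \<subseteq> \<D>"
    using infinite_countable_subset[OF \<D>(2)] by auto
  have "\<exists>n. f n \<inter> K = {}" if "compactin X K" for K
  proof (rule ccontr)
    assume "\<nexists>n. f n \<inter> K = {}"
    then have "range f \<subseteq> {D \<in> \<D>. D \<inter> K \<noteq> {}}"
      using f(2) by blast
    then have "finite (range f)"
      by (rule finite_subset) (rule discrete_family_finite_meeting_compact[OF \<D>(3) that])
    then show False
      using range_inj_infinite[OF f(1)] by simp
  qed
  then show ?thesis
    using f(2) \<D>(1) by blast
qed

section \<open>Replies of a strategy and the plays that follow it\<close>

lemma GKF_F_strategy_reply:
  assumes "GKF_F_strategy X \<sigma>" "\<forall>K\<in>set Ks. compactin X K" "compactin X K"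
  shows "finite (\<sigma> (Ks @ [K]))" "\<sigma> (Ks @ [K]) \<subseteq> isolated_points X" "\<sigma> (Ks @ [K]) \<inter> K = {}"
proof -
  have "finite (\<sigma> (Ks @ [K])) \<and> \<sigma> (Ks @ [K]) \<subseteq> isolated_points X - last (Ks @ [K])"
    using assms unfolding GKF_F_strategy_def by (metis Un_iff set_append append_is_Nil_conv
        not_Cons_self2 empty_iff empty_set set_ConsD)
  then show "finite (\<sigma> (Ks @ [K]))" "\<sigma> (Ks @ [K]) \<subseteq> isolated_points X" "\<sigma> (Ks @ [K]) \<inter> K = {}"
    by auto
qed

lemma GKF_F_strategy_play:
  assumes "GKF_F_strategy X \<sigma>" "\<And>n. compactin X (K n)"
  shows "GKF_play X K (\<lambda>n. \<sigma> (map K [0..<Suc n]))"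
proof -
  have "finite (\<sigma> (map K [0..<Suc n])) \<and> \<sigma> (map K [0..<Suc n]) \<subseteq> isolated_points X
      \<and> \<sigma> (map K [0..<Suc n]) \<inter> K n = {}" for n
    using GKF_F_strategy_reply[OF assms(1), of "map K [0..<n]" "K n"] assms(2) by auto
  then show ?thesis
    using assms(2) unfolding GKF_play_def by blast
qed

text \<open>The strategy looks only at the last move. If it lost a play, its non-empty replies would
  be pairwise distinct, so they would form an infinite discrete subfamily of
  \<open>\<F>\<close>.\<close>

lemma GKF_F_winning_strategyI:
  assumes "moving_off X \<F>" and fin: "\<And>F. F \<in> \<F> \<Longrightarrow> finite F \<and> F \<subseteq> isolated_points X"
    and no_sub: "\<And>\<D>. \<D> \<subseteq> \<F> \<Longrightarrow> infinite \<D> \<Longrightarrow> \<not> discrete_family X \<D>"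
  shows "\<exists>\<sigma>. GKF_F_winning_strategy X \<sigma>"
proof -
  obtain r where r: "\<And>K. compactin X K \<Longrightarrow> r K \<in> \<F> \<and> r K \<noteq> {} \<and> K \<inter> r K = {}"
    using assms(1) unfolding moving_off_def by metis
  have "GKF_F_strategy X (\<lambda>Ks. r (last Ks))"
    unfolding GKF_F_strategy_def
  proof (intro allI impI)
    fix Ks assume "Ks \<noteq> [] \<and> (\<forall>K\<in>set Ks. compactin X K)"
    then have "compactin X (last Ks)"
      by simp
    from r[OF this] show "finite (r (last Ks)) \<and> r (last Ks) \<subseteq> isolated_points X - last Ks"
      using fin[of "r (last Ks)"] by auto
  qed
  moreover have "\<not> GKF_K_wins X F"
    if play: "GKF_play X K F" and F: "\<forall>n. F n = r (last (map K [0..<Suc n]))" for K F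
  proof
    assume "GKF_K_wins X F"
    then have disc: "discrete_sequence X F"
      by (simp add: GKF_K_wins_def)
    have Fr: "F n \<in> \<F>" "F n \<noteq> {}" for n
      using F r play by (simp_all add: GKF_play_def)
    moreover have "F n \<subseteq> topspace X" for n
      using fin[OF Fr(1)] isolated_points_subset_topspace by (meson subset_trans)
    ultimately have "inj F"
      using discrete_sequence_inj[OF disc] by simp
    then have "infinite (range F)"
      by (rule range_inj_infinite)
    moreover have "range F \<subseteq> \<F>"
      using Fr(1) by auto
    ultimately show False
      using no_sub discrete_sequence_imp_family[OF disc] by simp
  qed
  ultimately show ?thesis
    unfolding GKF_F_winning_strategy_def by blast
qed

section \<open>Defeating a strategy with non-empty replies\<close>

lemma DMOP_nonempty_strategy_defeated:
  fixes X :: "'a topology"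
  assumes "DMOP X" and strat: "GKF_F_strategy X \<sigma>" and ne: "\<And>Ks. \<sigma> Ks \<noteq> {}"
  shows "\<exists>K. (\<forall>n. compactin X (K n)) \<and> discrete_sequence X (\<lambda>n. \<sigma> (map K [0..<Suc n]))"
proof -
  have "\<exists>c :: nat \<Rightarrow> 'a set. (\<forall>n. compactin X (c n)) \<and>
      (\<forall>K. compactin X K \<longrightarrow> (\<exists>n. \<sigma> (Ks @ [c n]) \<inter> K = {}))"
    if Ks: "\<forall>K\<in>set Ks. compactin X K" for Ks :: "'a set list"
  proof -
    \<comment> \<open>All replies available after \<open>Ks\<close>; the family is moving off
      because the reply to \<open>K\<close> is non-empty and misses \<open>K\<close>.\<close>
    let ?\<F> = "{\<sigma> (Ks @ [K]) |K. compactin X K}"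
    note reply = GKF_F_strategy_reply[OF strat Ks]
    have fin: "finite F \<and> F \<subseteq> isolated_points X" if "F \<in> ?\<F>" for F
      using that reply by blast
    moreover have "moving_off X ?\<F>"
      unfolding moving_off_def
    proof (intro conjI ballI allI impI)
      show "F \<subseteq> topspace X" if "F \<in> ?\<F>" for F
        using fin[OF that] isolated_points_subset_topspace by (meson subset_trans)
      show "\<exists>F\<in>?\<F>. F \<noteq> {} \<and> K \<inter> F = {}" if "compactin X K" for K
        using that ne[of "Ks @ [K]"] reply(3)[OF that] by blast
    qed
    ultimately obtain f :: "nat \<Rightarrow> 'a set" where f: "range f \<subseteq> ?\<F>"
      and miss: "\<forall>K. compactin X K \<longrightarrow> (\<exists>n. f n \<inter> K = {})"
      using DMOP_countable_moving_off[OF \<open>DMOP X\<close>] by meson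
    then have "\<forall>n. \<exists>K. f n = \<sigma> (Ks @ [K]) \<and> compactin X K"
      by blast
    then obtain c where "\<And>n. f n = \<sigma> (Ks @ [c n]) \<and> compactin X (c n)"
      by metis
    with miss show ?thesis
      by metis
  qed
  then obtain c :: "'a set list \<Rightarrow> nat \<Rightarrow> 'a set" where c: "\<And>Ks. \<forall>K\<in>set Ks. compactin X K \<Longrightarrow>
      (\<forall>n. compactin X (c Ks n)) \<and>
      (\<forall>K. compactin X K \<longrightarrow> (\<exists>n. \<sigma> (Ks @ [c Ks n]) \<inter> K = {}))"
    by metis

  txt \<open>Nodes of the tree are lists of move numbers, the latest move first.\<close>
  define pos where "pos = rec_list [] (\<lambda>n s p. p @ [c p n])"
  have pos_simps: "pos [] = []" "\<And>n s. pos (n # s) = pos s @ [c (pos s) n]"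
    by (simp_all add: pos_def)
  have pos: "\<forall>K\<in>set (pos s). compactin X K" for s
    by (induction s) (use c in \<open>auto simp: pos_simps\<close>)
  have reply: "finite (\<sigma> (pos (n # s)))" "\<sigma> (pos (n # s)) \<subseteq> isolated_points X" for n s
    using GKF_F_strategy_reply(1,2)[OF strat pos] c[OF pos] by (simp_all add: pos_simps)

  \<comment> \<open>\<open>T n\<close> consists of the root and the first \<open>n\<close> nodes in
    the enumeration \<open>from_nat\<close>. The root is inserted separately so that it is handled
    even when \<open>n\<close> is 0. In \<open>H g\<close> the number \<open>g []\<close> serves
    twice: as the move chosen at the root and as the bound on the nodes handled.\<close>
  define T :: "nat \<Rightarrow> nat list set" where "T n = insert [] (from_nat ` {..<n})" for n
  define H where "H g = (\<Union>t\<in>T (g []). \<sigma> (pos (g t # t)))" for g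
  have root: "\<sigma> (pos [g []]) \<subseteq> H g" for g
    by (auto simp: H_def T_def)
  have H_fin: "finite (H g) \<and> H g \<subseteq> isolated_points X" for g
    unfolding H_def T_def using reply(1) by (intro conjI finite_UN_I UN_least reply(2)) auto
  have "moving_off X (range H)"
    unfolding moving_off_def
  proof (intro conjI ballI allI impI)
    show "F \<subseteq> topspace X" if "F \<in> range H" for F
      using that H_fin isolated_points_subset_topspace by (metis imageE subset_trans)
    fix K assume "compactin X K"
    then have "\<forall>t. \<exists>n. \<sigma> (pos (n # t)) \<inter> K = {}"
      using c[OF pos] by (simp add: pos_simps)
    \<comment> \<open>One selector avoids \<open>K\<close> at all nodes simultaneously, so
      \<open>H g\<close> misses \<open>K\<close> whatever the value of \<open>g []\<close>
      is.\<close>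
    then obtain g where "\<And>t. \<sigma> (pos (g t # t)) \<inter> K = {}"
      by metis
    then have "K \<inter> H g = {}"
      by (auto simp: H_def)
    moreover have "H g \<noteq> {}"
      using root ne by blast
    ultimately show "\<exists>F\<in>range H. F \<noteq> {} \<and> K \<inter> F = {}"
      by blast
  qed
  then obtain \<D> where \<D>: "\<D> \<subseteq> range H" "infinite \<D>" "discrete_family X \<D>"
    using DMOP_E[OF \<open>DMOP X\<close>] H_fin by (metis imageE)
  then have "\<forall>D\<in>\<D>. \<exists>g. D = H g"
    by auto
  from bchoice[OF this] obtain g where "\<forall>D\<in>\<D>. D = H (g D)" ..
  then have g: "D = H (g D)" if "D \<in> \<D>" for D
    using that by (rule bspec)
  \<comment> \<open>Members with the same root move share the non-empty reply to it, and distinct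
    members of a discrete family are disjoint.\<close>
  have "inj_on (\<lambda>D. g D []) \<D>"
  proof (rule inj_onI)
    fix D E assume DE: "D \<in> \<D>" "E \<in> \<D>" "g D [] = g E []"
    obtain x where x: "x \<in> \<sigma> (pos [g D []])"
      using ne[of "pos [g D []]"] by auto
    then have "x \<in> H (g D)" "x \<in> H (g E)"
      using root[of "g D"] root[of "g E"] DE(3) by auto
    then have "x \<in> D" "x \<in> E"
      unfolding g[OF DE(1), symmetric] g[OF DE(2), symmetric] .
    moreover have "x \<in> topspace X"
      using x reply(2) isolated_points_subset_topspace by (meson subsetD)
    ultimately show "D = E"
      using discrete_family_meet_eq[OF \<D>(3) DE(1,2)] by simp
  qed
  then have "infinite ((\<lambda>D. g D []) ` \<D>)"
    using \<D>(2) by (simp add: finite_image_iff)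
  then have unbounded: "\<exists>D\<in>\<D>. m < g D []" for m
    unfolding infinite_nat_iff_unbounded by blast
  \<comment> \<open>Each \<open>z n\<close> pairs a node with a member of \<open>\<D>\<close> that
    handles it. The next node is the child selected by that member; the clause for
    \<open>n = 0\<close> starts the branch at the root.\<close>
  have "\<exists>z. \<forall>n. (snd (z n) \<in> \<D> \<and> fst (z n) \<in> T (g (snd (z n)) []) \<and> (n = 0 \<longrightarrow> fst (z n) = [])) \<and>
    (fst (z (Suc n)) = g (snd (z n)) (fst (z n)) # fst (z n) \<and>
     g (snd (z n)) [] < g (snd (z (Suc n))) [])"
  proof (rule dependent_nat_choice)
    obtain D where "D \<in> \<D>"
      using unbounded by blast
    then show "\<exists>x. snd x \<in> \<D> \<and> fst x \<in> T (g (snd x) []) \<and> ((0::nat) = 0 \<longrightarrow> fst x = [])"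
      by (intro exI[of _ "([], D)"]) (simp add: T_def)
  next
    fix x :: "nat list \<times> 'a set" and n :: nat
    define t where "t = g (snd x) (fst x) # fst x"
    \<comment> \<open>The bound on \<open>g D []\<close> makes \<open>D\<close> handle the child
      \<open>t\<close>, whose code is \<open>to_nat t\<close>, and makes \<open>D\<close> differ
      from the previous member.\<close>
    obtain D where D: "D \<in> \<D>" "max (g (snd x) []) (to_nat t) < g D []"
      using unbounded by blast
    have "from_nat (to_nat t) \<in> T (g D [])"
      unfolding T_def using D(2) by (intro insertI2 imageI) simp
    then have "t \<in> T (g D [])"
      by simp
    with D show "\<exists>y. (snd y \<in> \<D> \<and> fst y \<in> T (g (snd y) []) \<and> (Suc n = 0 \<longrightarrow> fst y = [])) \<and>
        fst y = g (snd x) (fst x) # fst x \<and> g (snd x) [] < g (snd y) []"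
      by (intro exI[of _ "(t, D)"]) (simp add: t_def)
  qed
  then obtain z where z: "\<And>n. snd (z n) \<in> \<D>" "\<And>n. fst (z n) \<in> T (g (snd (z n)) [])"
    "\<And>n. fst (z (Suc n)) = g (snd (z n)) (fst (z n)) # fst (z n)"
    "\<And>n. g (snd (z n)) [] < g (snd (z (Suc n))) []" "fst (z 0) = []"
    by auto
  define t where "t n = fst (z n)" for n
  define D where "D n = snd (z n)" for n
  note z = z[folded t_def D_def]
  have "strict_mono (\<lambda>n. g (D n) [])"
    using z(4) by (simp add: strict_mono_Suc_iff)
  then have "inj D"
    by (metis injI strict_mono_eq)
  then have disc: "discrete_sequence X D"
    using discrete_sequence_of_family[OF \<D>(3)] z(1) by (simp add: image_subset_iff)

  \<comment> \<open>The moves along the branch: at node \<open>t n\<close> the selector of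
    \<open>D n\<close> decides.\<close>
  define K where "K n = c (pos (t n)) (g (D n) (t n))" for n
  have K: "compactin X (K n)" for n
    using c[OF pos] by (simp add: K_def)
  have map_K: "map K [0..<n] = pos (t n)" for n
    by (induction n) (simp_all add: z(3,5) pos_simps K_def)
  \<comment> \<open>Since \<open>t n\<close> is handled by \<open>D n\<close>, the reply is one of
    the sets whose union is \<open>D n\<close>.\<close>
  have "\<sigma> (map K [0..<Suc n]) \<subseteq> D n" for n
  proof -
    have "\<sigma> (pos (g (D n) (t n) # t n)) \<subseteq> H (g (D n))"
      unfolding H_def using z(2) by blast
    then show ?thesis
      unfolding map_K z(3) using g[OF z(1)] by blast
  qed
  then have "discrete_sequence X (\<lambda>n. \<sigma> (map K [0..<Suc n]))"
    by (rule discrete_sequence_mono[OF disc])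
  then show ?thesis
    using K by auto
qed

section \<open>Reduction to non-empty replies and the equivalence\<close>

text \<open>Discreteness passes to smaller sets, so it suffices to defeat a strategy whose replies
  contain those of \<open>\<sigma>\<close> and are never empty.\<close>

lemma DMOP_imp_no_winning_strategy:
  assumes "DMOP X"
  shows "\<not> GKF_F_winning_strategy X \<sigma>"
proof
  assume win: "GKF_F_winning_strategy X \<sigma>"
  then have strat: "GKF_F_strategy X \<sigma>"
    by (simp add: GKF_F_winning_strategy_def)
  have not_disc: "\<not> discrete_sequence X (\<lambda>n. \<sigma> (map K [0..<Suc n]))"
    if "\<And>n. compactin X (K n)" for K
  proof -
    have "GKF_play X K (\<lambda>n. \<sigma> (map K [0..<Suc n]))"
      using GKF_F_strategy_play[OF strat] that by simp
    then show ?thesis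
      using conjunct2[OF win[unfolded GKF_F_winning_strategy_def GKF_K_wins_def]]
      by (elim allE[of _ K] allE[of _ "\<lambda>n. \<sigma> (map K [0..<Suc n])"]) (simp only: simp_thms)
  qed
  \<comment> \<open>If \<open>K\<close> contained all isolated points, repeating it forever would
    force empty replies, and a sequence of empty sets is discrete.\<close>
  have nonempty: "isolated_points X - K \<noteq> {}" if K: "compactin X K" for K
  proof
    assume empty: "isolated_points X - K = {}"
    have "GKF_play X (\<lambda>_. K) (\<lambda>n. \<sigma> (map (\<lambda>_. K) [0..<Suc n]))"
      by (rule GKF_F_strategy_play[OF strat K])
    then have "\<sigma> (map (\<lambda>_. K) [0..<Suc n]) = {}" for n
      using empty unfolding GKF_play_def by blast
    then have "discrete_sequence X (\<lambda>n. \<sigma> (map (\<lambda>_. K) [0..<Suc n]))"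
      unfolding discrete_sequence_def Uniq_def by (metis inf_bot_left openin_topspace)
    with not_disc[of "\<lambda>_. K", OF K] show False
      by contradiction
  qed
  \<comment> \<open>A singleton replaces each empty reply, so \<open>\<tau>\<close> is non-empty on
    every list; on lists that are no legal position the chosen point may be arbitrary.\<close>
  define \<tau> where "\<tau> Ks = (if \<sigma> Ks = {} then {SOME x. x \<in> isolated_points X - last Ks} else \<sigma> Ks)"
    for Ks
  have "GKF_F_strategy X \<tau>"
    unfolding GKF_F_strategy_def
  proof (intro allI impI)
    fix Ks assume Ks: "Ks \<noteq> [] \<and> (\<forall>K\<in>set Ks. compactin X K)"
    then have "(SOME x. x \<in> isolated_points X - last Ks) \<in> isolated_points X - last Ks"
      using nonempty[of "last Ks"] by (metis last_in_set some_in_eq)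
    then show "finite (\<tau> Ks) \<and> \<tau> Ks \<subseteq> isolated_points X - last Ks"
      using Ks strat unfolding \<tau>_def GKF_F_strategy_def by simp
  qed
  moreover have "\<tau> Ks \<noteq> {}" for Ks
    by (simp add: \<tau>_def)
  ultimately obtain K where K: "\<And>n. compactin X (K n)"
    and disc: "discrete_sequence X (\<lambda>n. \<tau> (map K [0..<Suc n]))"
    using DMOP_nonempty_strategy_defeated[OF assms] by blast
  have "\<sigma> Ks \<subseteq> \<tau> Ks" for Ks
    by (simp add: \<tau>_def)
  then have "discrete_sequence X (\<lambda>n. \<sigma> (map K [0..<Suc n]))"
    by (intro discrete_sequence_mono[OF disc])
  with not_disc[OF K] show False
    by contradiction
qed

theorem theorem2p4:
  fixes X :: "'a topology"
  shows "DMOP X \<longleftrightarrow> (\<nexists>\<sigma>. GKF_F_winning_strategy X \<sigma>)"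
proof
  show "\<nexists>\<sigma>. GKF_F_winning_strategy X \<sigma>" if "DMOP X"
    using DMOP_imp_no_winning_strategy[OF that] by blast
  show "DMOP X" if "\<nexists>\<sigma>. GKF_F_winning_strategy X \<sigma>"
    unfolding DMOP_def using that GKF_F_winning_strategyI by metis
qed

end
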